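(* For every integer $r\geq 1$ and all real numbers $s_1,\ldots,s_r>1$, $$T(s_1,\ldots,s_r) < 0.$$
   Context: For real numbers $s_1,\ldots,s_r>1$, define the (absolutely convergent) series $$T(s_1,\ldots,s_r) = \sum_{n_1\geq_2 \cdots \geq_2 n_r\geq 1} \frac{(-1)^{n_1+\cdots + n_r}}{n_1^{s_1}\cdots n_r^{s_r}},$$ where the $n_i$ are integers and $n\geq_2 m$ means "$n\geq m$, with equality only if $n$ is even". *)

theory Defs
  imports "HOL-Analysis.Infinite_Sum"
begin

definition geq2 :: "nat \<Rightarrow> nat \<Rightarrow> bool" (infix "\<ge>\<^sub>2" 50)
  where "n \<ge>\<^sub>2 m \<longleftrightarrow> n \<ge> m \<and> (n = m \<longrightarrow> even n)"

(* Index tuples (n_1, ..., n_r) as lists; the lower bound on the last entry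
   makes all entries positive. *)
definition T_indices :: "nat \<Rightarrow> nat list set"
  where "T_indices r = {ns. length ns = r \<and> successively (\<ge>\<^sub>2) ns \<and> last ns \<ge> 1}"

(* Meant for nonempty s. For a real-valued family, infsum is the sum of the
   absolutely convergent series, and it is 0 if the family is not absolutely
   summable; T s < 0 therefore also entails absolute convergence. *)
definition T :: "real list \<Rightarrow> real"
  where "T s = (\<Sum>\<^sub>\<infinity>ns\<in>T_indices (length s).
      (-1) ^ (\<Sum>i<length s. ns ! i) / (\<Prod>i<length s. real (ns ! i) powr (s ! i)))"

end

theory Submission
  imports Defs "HOL-Analysis.Summation_Tests"
begin

text \<open>
  The relation \<open>n \<ge>\<^sub>2 m\<close> says exactly that \<open>m\<close> is at most the largest even number below or
  equal to \<open>n\<close>. Hence, once \<open>n\<^sub>1 = n\<close> is chosen, the sum over the remaining indices depends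
  only on \<open>j = n div 2\<close>: it is the truncation \<open>C j\<close> of the shorter series to \<open>n\<^sub>2 \<le> 2 * j\<close>.
  Writing \<open>x n = n powr - s\<^sub>1\<close>, the truncation of the whole series to \<open>n\<^sub>1 \<le> 2 * k\<close> is

  \<open>\<Sum>n=1..2*k. (-1) ^ n * x n * C (n div 2)
    = (\<Sum>j=1..<k. C j * (x (2 * j) - x (2 * j + 1))) + C k * x (2 * k)\<close>,

  where the term \<open>n = 1\<close> vanishes because \<open>C 0\<close> is an empty sum. As \<open>x\<close> is positive and
  decreasing, negativity of every \<open>C j\<close> with \<open>j \<ge> 1\<close> passes to all these truncations, so
  induction on the number of exponents applies. It starts with a single exponent, where the
  terms pair up as \<open>x (2 * j) - x (2 * j - 1) < 0\<close>.

  To keep strictness in the limit, the induction yields a negative bound that is uniform in \<open>k\<close>: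
  \<open>x 2 - x 1\<close> for one exponent, \<open>C 1 * (x 2 - x 3)\<close> for several
  (\<open>chain_sum_alt_power_bounded_away\<close>). Absolute convergence, which needs exponents
  above 1, identifies the infinite sum with the limit of its truncations
  (\<open>chain_sum_tendsto_infsum\<close>).
\<close>

section \<open>Truncated sums over chains\<close>

definition chains_upto :: "nat \<Rightarrow> nat \<Rightarrow> nat list set"
  where "chains_upto r m = {ns \<in> T_indices r. hd ns \<le> m}"

text \<open>
  Each position of a chain has a weight function of its own. This lets the signed terms and their
  absolute values share one recursion.
\<close>

definition weight :: "(nat \<Rightarrow> real) list \<Rightarrow> nat list \<Rightarrow> real"
  where "weight us ns = (\<Prod>i<length us. (us ! i) (ns ! i))"

definition chain_sum :: "(nat \<Rightarrow> real) list \<Rightarrow> nat \<Rightarrow> real"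
  where "chain_sum us m = (\<Sum>ns\<in>chains_upto (length us) m. weight us ns)"

lemma weight_Cons: "weight (u # us) (n # ns) = u n * weight us ns"
  by (simp add: weight_def prod.lessThan_Suc_shift del: prod.lessThan_Suc)

text \<open>
  An odd \<open>n\<close> excludes equality and so allows only \<open>m \<le> n - 1\<close>. In this form, an even number and
  its odd successor visibly admit the same continuations of a chain.
\<close>

lemma geq2_iff_le_even_part: "n \<ge>\<^sub>2 m \<longleftrightarrow> m \<le> 2 * (n div 2)"
  unfolding geq2_def by presburger

text \<open>
  Index tuples bound only the last entry from below; monotonicity carries that bound to the head.
\<close>

lemma last_le_hd:
  "ns \<noteq> [] \<Longrightarrow> successively (\<ge>\<^sub>2) ns \<Longrightarrow> last ns \<le> hd ns"
proof (induction ns)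
  case (Cons n ns)
  then show ?case
    by (cases "ns = []") (auto simp: successively_Cons geq2_def)
qed simp

lemma hd_ge_1: "ns \<in> T_indices r \<Longrightarrow> r > 0 \<Longrightarrow> hd ns \<ge> 1"
  using last_le_hd[of ns] by (fastforce simp: T_indices_def)

lemma chains_upto_0: "r > 0 \<Longrightarrow> chains_upto r 0 = {}"
  using hd_ge_1[of _ r] by (force simp: chains_upto_def)

lemma chains_upto_1: "chains_upto (Suc 0) m = (\<lambda>n. [n]) ` {1..m}"
  by (auto simp: chains_upto_def T_indices_def length_Suc_conv)

lemma chains_upto_Suc:
  assumes "r > 0"
  shows "chains_upto (Suc r) m = (\<Union>n\<in>{1..m}. (#) n ` chains_upto r (2 * (n div 2)))"
    (is "?L = ?R")
proof
  show "?L \<subseteq> ?R"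
  proof
    fix ns assume ns: "ns \<in> ?L"
    then obtain n ns' where eq: "ns = n # ns'"
      by (auto simp: chains_upto_def T_indices_def length_Suc_conv)
    have "n \<ge> 1"
      using hd_ge_1[of ns "Suc r"] ns eq by (simp add: chains_upto_def)
    moreover have "ns' \<noteq> []"
      using ns eq assms by (auto simp: chains_upto_def T_indices_def)
    ultimately show "ns \<in> ?R"
      using ns eq
      by (auto simp: chains_upto_def T_indices_def successively_Cons geq2_iff_le_even_part)
  qed
  show "?R \<subseteq> ?L"
    using assms
    by (auto simp: chains_upto_def T_indices_def successively_Cons geq2_iff_le_even_part)
qed

lemma finite_chains_upto: "r > 0 \<Longrightarrow> finite (chains_upto r m)"
proof (induction r arbitrary: m)
  case (Suc r)
  then show ?case
    by (cases "r = 0") (simp_all add: chains_upto_1 chains_upto_Suc)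
qed simp

lemma chains_upto_subset: "chains_upto r m \<subseteq> T_indices r"
  by (auto simp: chains_upto_def)

lemma chains_upto_exhaust:
  assumes "finite X" "X \<subseteq> T_indices r"
  shows "\<exists>M. \<forall>m\<ge>M. X \<subseteq> chains_upto r m"
proof (intro exI allI impI)
  fix m assume "m \<ge> Max (insert 0 (hd ` X))"
  then show "X \<subseteq> chains_upto r m"
    using assms by (auto simp: chains_upto_def)
qed

lemma chain_sum_0: "us \<noteq> [] \<Longrightarrow> chain_sum us 0 = 0"
  by (simp add: chain_sum_def chains_upto_0)

lemma chain_sum_single: "chain_sum [u] m = (\<Sum>n=1..m. u n)"
  by (simp add: chain_sum_def chains_upto_1 sum.reindex inj_on_def weight_def)

text \<open>
  The inner sum takes the same value at \<open>n = 2 * j\<close> and \<open>n = 2 * j + 1\<close>; with two or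
  more exponents, such a pair of terms can therefore be compared through its outer weights alone.
\<close>

lemma chain_sum_Cons:
  assumes "us \<noteq> []"
  shows "chain_sum (u # us) m = (\<Sum>n=1..m. u n * chain_sum us (2 * (n div 2)))"
proof -
  have "chain_sum (u # us) m
      = (\<Sum>n=1..m. \<Sum>ns\<in>(#) n ` chains_upto (length us) (2 * (n div 2)). weight (u # us) ns)"
    using assms unfolding chain_sum_def
    by (simp add: chains_upto_Suc, subst sum.UNION_disjoint) (auto simp: finite_chains_upto)
  also have "\<dots> = (\<Sum>n=1..m. u n * chain_sum us (2 * (n div 2)))"
    by (simp add: chain_sum_def sum.reindex weight_Cons sum_distrib_left)
  finally show ?thesis .
qed

section \<open>Negativity of the truncated alternating sums\<close>

definition alt_power :: "real \<Rightarrow> nat \<Rightarrow> real"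
  where "alt_power a n = (-1) ^ n / real n powr a"

text \<open>
  Odd indices are paired with the following even ones here. The pair \<open>x 1\<close>, \<open>x 2\<close> is the bound, and
  every later pair contributes a nonpositive amount.
\<close>

lemma alternating_sum_le:
  fixes x :: "nat \<Rightarrow> real"
  assumes decr: "\<And>n. n \<ge> 1 \<Longrightarrow> x (Suc n) \<le> x n" and "k \<ge> 1"
  shows "(\<Sum>n=1..2*k. (-1) ^ n * x n) \<le> x 2 - x 1"
  using assms(2)
proof (induction k rule: dec_induct)
  case base
  then show ?case by (simp add: numeral_2_eq_2)
next
  case (step k)
  have "x (2 * k + 2) \<le> x (2 * k + 1)"
    using decr[of "2 * k + 1"] by simp
  with step.IH show ?case by simp
qed

text \<open>
  With coefficients \<open>C (n div 2)\<close> the pairing is the opposite one, each even index with the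
  following odd one, since these share a coefficient. An upper limit \<open>2 * k\<close> leaves the last even
  term \<open>C k * x (2 * k)\<close> unpaired. The term \<open>C k * x (2 * k + 1)\<close> in the bound stands for it in the
  induction: it is what the next odd term cancels.
\<close>

lemma alternating_sum_negative_coeffs_le:
  fixes x C :: "nat \<Rightarrow> real"
  assumes decr: "\<And>n. n \<ge> 1 \<Longrightarrow> x (Suc n) \<le> x n" and "C 0 = 0" and neg: "\<And>j. j \<ge> 1 \<Longrightarrow> C j < 0" and "k \<ge> 1"
  shows "(\<Sum>n=1..2*k. (-1) ^ n * x n * C (n div 2)) \<le> C 1 * (x 2 - x 3) + C k * x (2 * k + 1)"
  using assms(4)
proof (induction k rule: dec_induct)
  case base
  then show ?case
    using assms(2) by (simp add: numeral_2_eq_2 numeral_3_eq_3 algebra_simps)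
next
  case (step k)
  have "x (2 * k + 3) \<le> x (2 * k + 2)"
    using decr[of "2 * k + 2"] by (simp add: numeral_3_eq_3)
  then have "C (Suc k) * x (2 * k + 2) \<le> C (Suc k) * x (2 * k + 3)"
    using neg[of "Suc k"] by (intro mult_left_mono_neg) auto
  with step.IH show ?case by (simp add: numeral_3_eq_3 algebra_simps)
qed


text \<open>
  Negativity of the truncations alone would give only a nonpositive limit, hence the bound \<open>c\<close>. For
  the induction itself negativity is enough: with several exponents the new \<open>c\<close> comes from the single
  coefficient \<open>C 1\<close>. Only even truncations are controlled: those at \<open>2 * j\<close> are the ones
  that recur as coefficients.
\<close>

lemma chain_sum_alt_power_bounded_away:
  assumes "s \<noteq> []" and "\<forall>a\<in>set s. a > 0"
  shows "\<exists>c<0. \<forall>k\<ge>1. chain_sum (map alt_power s) (2 * k) \<le> c"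
  using assms
proof (induction s)
  case (Cons a s)
  define x where "x n = real n powr - a" for n
  have alt: "alt_power a n = (-1) ^ n * x n" for n
    by (simp add: alt_power_def x_def powr_minus divide_inverse)
  have less: "x (Suc n) < x n" if "n \<ge> 1" for n
    using Cons.prems that unfolding x_def by (intro powr_less_mono2_neg) auto
  then have decr: "x (Suc n) \<le> x n" if "n \<ge> 1" for n
    using that less_imp_le by blast
  show ?case
  proof (cases "s = []")
    case True
    have "chain_sum (map alt_power (a # s)) (2 * k) \<le> x 2 - x 1" if "k \<ge> 1" for k
      using alternating_sum_le[of x k] decr that by (simp add: True chain_sum_single alt)
    moreover have "x 2 - x 1 < 0"
      using less[of 1] by (simp add: numeral_2_eq_2)
    ultimately show ?thesis by blast
  next
    case False
    define C where "C j = chain_sum (map alt_power s) (2 * j)" for j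
    have neg: "C j < 0" if "j \<ge> 1" for j
      using Cons.IH Cons.prems False that unfolding C_def by fastforce
    have C0: "C 0 = 0"
      using False by (simp add: C_def chain_sum_0)
    have "chain_sum (map alt_power (a # s)) (2 * k) \<le> C 1 * (x 2 - x 3)" if "k \<ge> 1" for k
    proof -
      have "chain_sum (map alt_power (a # s)) (2 * k)
          = (\<Sum>n=1..2*k. (-1) ^ n * x n * C (n div 2))"
        using False by (simp add: chain_sum_Cons alt C_def)
      also have "\<dots> \<le> C 1 * (x 2 - x 3) + C k * x (2 * k + 1)"
        by (rule alternating_sum_negative_coeffs_le) (use decr C0 neg that in auto)
      also have "C k * x (2 * k + 1) \<le> 0"
        using neg[OF that] by (intro mult_nonpos_nonneg) (auto simp: x_def)
      finally show ?thesis by simp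
    qed
    moreover have "C 1 * (x 2 - x 3) < 0"
      using neg[of 1] less[of 2] by (intro mult_neg_pos) (auto simp: numeral_3_eq_3)
    ultimately show ?thesis by blast
  qed
qed simp

section \<open>Absolute convergence\<close>

text \<open>
  For nonnegative weights, dropping the chain condition can only enlarge the sum, which is then a
  product of partial sums of convergent series; the recursion applies this one factor at a time.
\<close>

lemma chain_sum_bounded:
  assumes "us \<noteq> []" and "\<And>u. u \<in> set us \<Longrightarrow> summable u \<and> (\<forall>n. u n \<ge> 0)"
  shows "\<exists>K\<ge>0. \<forall>m. chain_sum us m \<le> K"
  using assms
proof (induction us)
  case (Cons u us)
  have u: "summable u" "\<And>n. u n \<ge> 0"
    using Cons.prems by auto
  have partial: "(\<Sum>n=1..m. u n) \<le> suminf u" for m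
    using u by (intro sum_le_suminf) auto
  have nonneg: "suminf u \<ge> 0"
    using u by (intro suminf_nonneg) auto
  show ?case
  proof (cases "us = []")
    case True
    then show ?thesis
      using partial nonneg by (auto simp: chain_sum_single)
  next
    case False
    then obtain K where K: "K \<ge> 0" "\<And>m. chain_sum us m \<le> K"
      using Cons.IH Cons.prems by (metis list.set_intros(2))
    have "chain_sum (u # us) m \<le> suminf u * K" for m
    proof -
      have "chain_sum (u # us) m \<le> (\<Sum>n=1..m. u n * K)"
        unfolding chain_sum_Cons[OF False] by (intro sum_mono mult_left_mono K u)
      also have "\<dots> \<le> suminf u * K"
        unfolding sum_distrib_right[symmetric] by (intro mult_right_mono partial K)
      finally show ?thesis .
    qed
    then show ?thesis
      using K nonneg by (metis mult_nonneg_nonneg)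
  qed
qed simp

lemma abs_weight: "\<bar>weight us ns\<bar> = weight (map (\<lambda>u n. \<bar>u n\<bar>) us) ns"
  unfolding weight_def abs_prod by (intro prod.cong) auto

text \<open>
  Every finite set of chains lies in a truncation, so the uniform bound on truncations of the
  absolute series bounds all its finite partial sums.
\<close>

lemma weight_abs_summable:
  assumes "us \<noteq> []" and "\<And>u. u \<in> set us \<Longrightarrow> summable (\<lambda>n. \<bar>u n\<bar>)"
  shows "weight us abs_summable_on T_indices (length us)"
proof -
  obtain K where K: "\<And>m. chain_sum (map (\<lambda>u n. \<bar>u n\<bar>) us) m \<le> K"
  proof -
    have "summable v \<and> (\<forall>n. v n \<ge> 0)" if v: "v \<in> set (map (\<lambda>u n. \<bar>u n\<bar>) us)" for v
    proof -
      obtain u where "u \<in> set us" "v = (\<lambda>n. \<bar>u n\<bar>)"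
        using v unfolding set_map by blast
      then show ?thesis
        using assms(2) by simp
    qed
    moreover have "map (\<lambda>u n. \<bar>u n\<bar>) us \<noteq> []"
      using assms(1) by simp
    ultimately show thesis
      using chain_sum_bounded that by blast
  qed
  have "(\<Sum>ns\<in>F. \<bar>weight us ns\<bar>) \<le> K" if F: "finite F" "F \<subseteq> T_indices (length us)" for F
  proof -
    obtain m where "F \<subseteq> chains_upto (length us) m"
      using chains_upto_exhaust[OF F] by blast
    then have "(\<Sum>ns\<in>F. \<bar>weight us ns\<bar>)
        \<le> (\<Sum>ns\<in>chains_upto (length us) m. \<bar>weight us ns\<bar>)"
      using assms(1) by (intro sum_mono2) (auto simp: finite_chains_upto)
    also have "\<dots> = chain_sum (map (\<lambda>u n. \<bar>u n\<bar>) us) m"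
      by (simp add: chain_sum_def abs_weight)
    also have "\<dots> \<le> K" by (rule K)
    finally show ?thesis .
  qed
  then show ?thesis
    by (intro nonneg_bdd_above_summable_on bdd_aboveI[where M = K]) auto
qed

text \<open>
  An infinite sum is a limit along all finite sets of indices; the truncations are a sequence of
  finite sets that eventually contains each of these, so it computes the same limit.
\<close>

lemma chain_sum_tendsto_infsum:
  assumes "us \<noteq> []" and "\<And>u. u \<in> set us \<Longrightarrow> summable (\<lambda>n. \<bar>u n\<bar>)"
  shows "chain_sum us \<longlonglongrightarrow> (\<Sum>\<^sub>\<infinity>ns\<in>T_indices (length us). weight us ns)"
proof -
  have "(sum (weight us) \<longlongrightarrow> infsum (weight us) (T_indices (length us)))
          (finite_subsets_at_top (T_indices (length us)))"
    using weight_abs_summable[OF assms] by (intro infsum_tendsto) (rule abs_summable_summable)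
  moreover have "filterlim (chains_upto (length us))
      (finite_subsets_at_top (T_indices (length us))) sequentially"
    unfolding filterlim_def le_filter_def eventually_filtermap eventually_finite_subsets_at_top
  proof safe
    fix P X
    assume X: "finite X" "X \<subseteq> T_indices (length us)"
      and P: "\<forall>Y. finite Y \<and> X \<subseteq> Y \<and> Y \<subseteq> T_indices (length us) \<longrightarrow> P Y"
    obtain M where M: "\<And>m. m \<ge> M \<Longrightarrow> X \<subseteq> chains_upto (length us) m"
      using chains_upto_exhaust[OF X] by blast
    have "P (chains_upto (length us) m)" if "m \<ge> M" for m
      using P M[OF that] assms(1) finite_chains_upto[of "length us" m] chains_upto_subset
      by blast
    then show "\<forall>\<^sub>F m in sequentially. P (chains_upto (length us) m)"
      by (auto simp: eventually_sequentially)
  qed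
  ultimately show ?thesis
    unfolding chain_sum_def by (rule filterlim_compose)
qed

lemma T_eq_infsum_weight:
  "T s = (\<Sum>\<^sub>\<infinity>ns\<in>T_indices (length s). weight (map alt_power s) ns)"
  by (simp add: T_def weight_def alt_power_def power_sum prod_dividef)

lemma summable_abs_alt_power: "a > 1 \<Longrightarrow> summable (\<lambda>n. \<bar>alt_power a n\<bar>)"
  using summable_real_powr_iff[of "-a"]
  by (simp add: alt_power_def abs_mult power_abs powr_minus divide_inverse)

theorem theorem2:
  fixes r :: nat and s :: "real list"
  assumes "r \<ge> 1"
    and "length s = r"
    and "\<forall>i<r. s ! i > 1"
  shows "T s < 0"
proof -
  have s: "s \<noteq> []" "\<forall>a\<in>set s. a > 1"
    using assms by (auto simp: in_set_conv_nth)
  then obtain c where c: "c < 0" "\<And>k. k \<ge> 1 \<Longrightarrow> chain_sum (map alt_power s) (2 * k) \<le> c"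
    using chain_sum_alt_power_bounded_away[of s] by force
  have "chain_sum (map alt_power s) \<longlonglongrightarrow> T s"
    unfolding T_eq_infsum_weight length_map[of alt_power s, symmetric]
    by (rule chain_sum_tendsto_infsum) (use s summable_abs_alt_power in auto)
  then have "(\<lambda>k. chain_sum (map alt_power s) (2 * k)) \<longlonglongrightarrow> T s"
    by (rule filterlim_compose) (auto intro!: filterlim_subseq simp: strict_mono_def)
  then have "T s \<le> c"
    by (rule LIMSEQ_le_const2) (use c in blast)
  with c show ?thesis by simp
qed

end
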